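(* Let $d \ge 0$ and $p \ge 1$ be integers. The topological closure $\overline{C_{\mathrm{END}}}$ is a $(pd+1)$-dimensional polyhedral cone in $\mathbb{R}^{p(d+1)}$ whose $H$-description is comprised of the volume equalities and the first-level inequalities; that is, $\overline{C_{\mathrm{END}}}$ is the set of all $h \in \mathbb{R}^{p(d+1)}$ satisfying the volume equalities $$\sum_{j=0}^d h_{r+1,j} = \sum_{j=0}^d h_{r,j} \quad \text{for each } r \in \{0,\dots,p-2\}$$ and the first-level inequalities $$\sum_{j=0}^d j\,h_{r+1,j} \le \sum_{j=0}^d j\,h_{r,j} \quad \text{for each } r \in \{0,\dots,p-2\}, \qquad \sum_{j=0}^d j\,h_{0,j} \le \sum_{j=0}^d (j+1)\,h_{p-1,j}.$$
   Context: A vector $h \in \mathbb{R}^{p(d+1)}$ is indexed as $h = (h_0, h_1, \dots, h_{p(d+1)-1})$, and we write $h_{r,j} := h_{jp+r}$ for $0 \le r \le p-1$ and $0 \le j \le d$. Put $h(z) := \sum_i h_i z^i$ and define $L_h : \mathbb{Z}_{\ge 0} \to \mathbb{R}$ by $\sum_{n \ge 0} L_h(n) z^n := h(z)/(1-z^p)^{d+1}$; equivalently, $L_h(tp+r) = \sum_{j=0}^d h_{r,j}\binom{t+d-j}{d}$ for $t \ge 0$, $0 \le r \le p-1$. For $N \in \mathbb{Z}_{\ge 0}$, let $C_N := \{h \in \mathbb{R}^{p(d+1)} : L_h(n+1) \ge L_h(n) \text{ for all integers } n \ge N\}$. The eventually nondecreasing cone is $C_{\mathrm{END}} := \bigcup_{N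 \ge 0} C_N$, and $\overline{C_{\mathrm{END}}}$ is its topological closure in $\mathbb{R}^{p(d+1)}$.
   Formalization: The description by volume equalities and first-level inequalities is asserted only for d ≥ 1: for d = 0 it fails, as h = (-1,…,-1) is in the cone but violates 0 ≤ h_{p-1,0}; polyhedral cone and dimension pd+1 are kept for all d ≥ 0. *)

theory Defs
  imports "HOL-Analysis.Analysis" "HOL-Computational_Algebra.Formal_Power_Series"
begin

text \<open>
  The space \<open>\<real>\<^bsup>p(d+1)\<^esup>\<close> is \<open>real ^ 'n\<close> for a finite type \<open>'n\<close>, together with an enumeration
  \<open>\<iota> :: nat \<Rightarrow> 'n\<close> of its coordinates, a bijection from \<open>{..<p * (d + 1)}\<close> onto \<open>UNIV\<close>:
  the number written \<open>h\<^sub>i\<close> is \<open>h $ \<iota> i\<close>.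
\<close>

definition block_coord :: "nat \<Rightarrow> (nat \<Rightarrow> 'n::finite) \<Rightarrow> real ^ 'n \<Rightarrow> nat \<Rightarrow> nat \<Rightarrow> real" where
  "block_coord p \<iota> h r j = h $ \<iota> (j * p + r)"

definition h_series :: "nat \<Rightarrow> nat \<Rightarrow> (nat \<Rightarrow> 'n::finite) \<Rightarrow> real ^ 'n \<Rightarrow> real fps" where
  "h_series d p \<iota> h = (\<Sum>i<p * (d + 1). fps_const (h $ \<iota> i) * fps_X ^ i)"

definition L :: "nat \<Rightarrow> nat \<Rightarrow> (nat \<Rightarrow> 'n::finite) \<Rightarrow> real ^ 'n \<Rightarrow> nat \<Rightarrow> real" where
  "L d p \<iota> h n = fps_nth (h_series d p \<iota> h / (1 - fps_X ^ p) ^ (d + 1)) n"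

definition nondecreasing_from :: "nat \<Rightarrow> nat \<Rightarrow> (nat \<Rightarrow> 'n::finite) \<Rightarrow> nat \<Rightarrow> (real ^ 'n) set" where
  "nondecreasing_from d p \<iota> N = {h. \<forall>n\<ge>N. L d p \<iota> h (n + 1) \<ge> L d p \<iota> h n}"

definition eventually_nondecreasing_cone :: "nat \<Rightarrow> nat \<Rightarrow> (nat \<Rightarrow> 'n::finite) \<Rightarrow> (real ^ 'n) set" where
  "eventually_nondecreasing_cone d p \<iota> = (\<Union>N. nondecreasing_from d p \<iota> N)"

definition volume_equalities :: "nat \<Rightarrow> nat \<Rightarrow> (nat \<Rightarrow> 'n::finite) \<Rightarrow> real ^ 'n \<Rightarrow> bool" where
  "volume_equalities d p \<iota> h \<longleftrightarrow>
     (\<forall>r. r + 1 < p \<longrightarrow>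
        (\<Sum>j\<le>d. block_coord p \<iota> h (r + 1) j) = (\<Sum>j\<le>d. block_coord p \<iota> h r j))"

text \<open>
  For \<open>d = 0\<close> the function \<open>L\<close> is \<open>p\<close>-periodic, so the eventually nondecreasing cone is the whole
  line of constant vectors, whereas the last inequality below reads \<open>0 \<le> h\<^bsub>p-1,0\<^esub>\<close> and cuts out
  a half-line. These inequalities describe the closed cone only for \<open>d \<ge> 1\<close>.
\<close>

definition first_level_inequalities :: "nat \<Rightarrow> nat \<Rightarrow> (nat \<Rightarrow> 'n::finite) \<Rightarrow> real ^ 'n \<Rightarrow> bool" where
  "first_level_inequalities d p \<iota> h \<longleftrightarrow>
     (\<forall>r. r + 1 < p \<longrightarrow>
        (\<Sum>j\<le>d. real j * block_coord p \<iota> h (r + 1) j) \<le> (\<Sum>j\<le>d. real j * block_coord p \<iota> h r j)) \<and>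
     (\<Sum>j\<le>d. real j * block_coord p \<iota> h 0 j) \<le> (\<Sum>j\<le>d. real (j + 1) * block_coord p \<iota> h (p - 1) j)"

end

theory Submission
  imports Defs
begin

text \<open>
  On each residue class modulo \<open>p\<close> the function \<open>L\<close> is a polynomial of degree at most \<open>d\<close>
  whose leading coefficient is a multiple of the block volume and whose second coefficient is
  governed by the first moment \<open>\<Sum>j. j h\<^bsub>r,j\<^esub>\<close>. Comparing consecutive residue classes
  cyclically, eventual monotonicity forces the volumes to agree and then the second coefficients
  to satisfy the first-level inequalities; conversely, equal volumes and strict inequalities
  suffice. A point with strict inequalities perturbs every solution of the weak inequalities into
  the cone, and makes the solution set full-dimensional in the space of the volume equalities.
\<close>

section \<open>The generating function and the block formula for \<open>L\<close>\<close>

text \<open>Supplies an explicit inverse of the denominator of the generating function. Each factor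
  \<open>1 - fps_X ^ p\<close> takes differences of coefficients at distance \<open>p\<close>, and
  Pascal's rule then lowers \<open>d\<close> by one.\<close>

lemma fps_binomial_series_dilated:
  fixes p d :: nat
  assumes "p \<ge> 1"
  shows "Abs_fps (\<lambda>n. if p dvd n then of_nat ((n div p + d) choose d) else 0)
           * (1 - fps_X ^ p) ^ (d + 1) = (1 :: real fps)"
proof (induction d)
  case 0
  show ?case
  proof (rule fps_ext)
    fix n
    show "fps_nth (Abs_fps (\<lambda>n. if p dvd n then of_nat ((n div p + 0) choose 0) else 0)
             * (1 - fps_X ^ p) ^ (0 + 1)) n = fps_nth (1 :: real fps) n"
      using assms
      by (auto simp: algebra_simps fps_X_power_mult_nth dvd_minus_self dest: dvd_imp_le)
  qed
next
  case (Suc d)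
  let ?G = "\<lambda>d. Abs_fps (\<lambda>n. if p dvd n then real ((n div p + d) choose d) else 0)"
  have "?G (Suc d) * (1 - fps_X ^ p) = ?G d"
  proof (rule fps_ext)
    fix n
    have "real (n div p + Suc d choose Suc d) - real ((n - p) div p + Suc d choose Suc d)
            = real (n div p + d choose d)" if "p \<le> n" "p dvd n"
    proof -
      from that obtain k where "n = p * Suc k"
        using assms by (metis dvd_def mult_0_right not0_implies_Suc le_zero_eq not_one_le_zero)
      then show ?thesis using assms by (simp add: algebra_simps)
    qed
    then show "fps_nth (?G (Suc d) * (1 - fps_X ^ p)) n = fps_nth (?G d) n"
      using assms
      by (auto simp: algebra_simps fps_X_power_mult_nth dvd_minus_self dest: dvd_imp_le)
  qed
  moreover have "?G (Suc d) * (1 - fps_X ^ p) ^ (Suc d + 1)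
      = (?G (Suc d) * (1 - fps_X ^ p)) * (1 - fps_X ^ p) ^ (d + 1)"
    by (simp add: mult.assoc)
  ultimately show ?case using Suc by (simp only:)
qed

text \<open>The inverse series is supported on multiples of \<open>p\<close>, so the coefficient at
  \<open>t * p + r\<close> receives from each block of \<open>p\<close> consecutive indices only the
  one congruent to \<open>r\<close>.\<close>

lemma L_block:
  assumes p: "p \<ge> 1" and r: "r < p"
  shows "L d p \<iota> h (t * p + r) = (\<Sum>j\<le>d. block_coord p \<iota> h r j * real ((t + d - j) choose d))"
proof -
  define G :: "real fps"
    where "G = Abs_fps (\<lambda>n. if p dvd n then of_nat ((n div p + d) choose d) else 0)"
  let ?n = "t * p + r"
  have G: "G * (1 - fps_X ^ p) ^ (d + 1) = 1"
    unfolding G_def using fps_binomial_series_dilated[OF p] .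
  have nz: "(1 - fps_X ^ p) ^ (d + 1) \<noteq> (0 :: real fps)"
    using G by (metis mult_zero_right zero_neq_one)
  have "h_series d p \<iota> h / (1 - fps_X ^ p) ^ (d + 1) = h_series d p \<iota> h * G"
  proof -
    have "h_series d p \<iota> h = (h_series d p \<iota> h * G) * (1 - fps_X ^ p) ^ (d + 1)"
      using G by (simp add: mult.assoc)
    then show ?thesis using nz by (metis nonzero_mult_div_cancel_right)
  qed
  then have "L d p \<iota> h ?n = (\<Sum>i<(d + 1) * p. h $ \<iota> i * (if ?n < i then 0 else fps_nth G (?n - i)))"
    by (simp add: L_def h_series_def sum_distrib_right fps_sum_nth mult.assoc
        fps_X_power_mult_nth mult.commute[of p])
  also have "\<dots> = (\<Sum>j<d+1. \<Sum>i\<in>{j*p..<j*p+p}. h $ \<iota> i * (if ?n < i then 0 else fps_nth G (?n - i)))"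
    by (rule sum.nat_group[symmetric])
  also have "\<dots> = (\<Sum>j<d+1. block_coord p \<iota> h r j * real ((t + d - j) choose d))"
  proof (rule sum.cong[OF refl])
    fix j assume "j \<in> {..<d+1}"
    then have j: "j \<le> d" by simp
    have "(if ?n < i then 0 else fps_nth G (?n - i))
        = (if i = j * p + r then real ((t + d - j) choose d) else 0)"
      if i: "i \<in> {j*p..<j*p+p}" for i
    proof (cases "i = j * p + r")
      case True
      show ?thesis
      \<comment> \<open>For \<open>t < j\<close> the index exceeds \<open>t * p + r\<close> and
        contributes 0; the binomial agrees, because its upper entry \<open>t + d - j\<close> is then
        below \<open>d\<close>.\<close>
      proof (cases "t < j")
        case True
        then have "t * p + p \<le> j * p" by (metis Suc_leI add.commute mult_Suc mult_le_mono1)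
        with True \<open>i = j * p + r\<close> r j show ?thesis by (simp add: binomial_eq_0)
      next
        case False
        then have "?n - i = (t - j) * p" "\<not> ?n < i"
          using \<open>i = j * p + r\<close> by (auto simp: diff_mult_distrib)
        with False \<open>i = j * p + r\<close> p show ?thesis by (simp add: G_def)
      qed
    next
      case False
      have "fps_nth G (?n - i) = 0" if "i \<le> ?n"
      proof -
        obtain s where s: "i = j * p + s" "s < p" using i by (auto simp: le_iff_add)
        have "\<not> p dvd ?n - i"
          using mod_eq_dvd_iff_nat[OF that, of p] s r False by auto
        then show ?thesis by (simp add: G_def)
      qed
      with False show ?thesis by auto
    qed
    then have "(\<Sum>i\<in>{j*p..<j*p+p}. h $ \<iota> i * (if ?n < i then 0 else fps_nth G (?n - i)))
        = (\<Sum>i\<in>{j*p..<j*p+p}. if i = j * p + r then h $ \<iota> i * real ((t + d - j) choose d) else 0)"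
      by (intro sum.cong) auto
    also have "\<dots> = block_coord p \<iota> h r j * real ((t + d - j) choose d)"
      using r by (simp add: block_coord_def)
    finally show "(\<Sum>i\<in>{j*p..<j*p+p}. h $ \<iota> i * (if ?n < i then 0 else fps_nth G (?n - i)))
        = block_coord p \<iota> h r j * real ((t + d - j) choose d)" .
  qed
  finally show ?thesis by (simp add: lessThan_Suc_atMost)
qed

section \<open>Asymptotics of shifted binomial coefficients\<close>

text \<open>The absorption identity splits off from the binomial one linear factor, asymptotic to
  \<open>t\<close>, and the divisor \<open>Suc k\<close>; the fixed shifts \<open>c\<close> and
  \<open>m\<close> do not reach the leading term.\<close>

lemma binomial_shift_asymptotic:
  "(\<lambda>t. real ((t + k + c - m) choose k) / real t ^ k) \<longlonglongrightarrow> 1 / fact k"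
proof (induction k)
  case 0
  show ?case by simp
next
  case (Suc k)
  have lin: "(\<lambda>t. (real t + (real k + 1 + real c - real m)) / real t) \<longlonglongrightarrow> 1"
  proof -
    have "(\<lambda>t. 1 + (real k + 1 + real c - real m) * (1 / real t))
        \<longlonglongrightarrow> 1 + (real k + 1 + real c - real m) * 0"
      by (intro tendsto_intros lim_1_over_n)
    moreover have "\<forall>\<^sub>F t in sequentially. 1 + (real k + 1 + real c - real m) * (1 / real t)
        = (real t + (real k + 1 + real c - real m)) / real t"
      using eventually_gt_at_top[of 0] by eventually_elim (simp add: field_simps)
    ultimately show ?thesis by (simp add: tendsto_cong)
  qed
  have "(\<lambda>t. (real t + (real k + 1 + real c - real m)) / real t *
          (real ((t + k + c - m) choose k) / real t ^ k) / real (Suc k))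
      \<longlonglongrightarrow> 1 * (1 / fact k) / real (Suc k)"
    by (intro tendsto_intros lin Suc) simp
  moreover have "\<forall>\<^sub>F t in sequentially. (real t + (real k + 1 + real c - real m)) / real t *
          (real ((t + k + c - m) choose k) / real t ^ k) / real (Suc k)
        = real ((t + Suc k + c - m) choose Suc k) / real t ^ Suc k"
    \<comment> \<open>Beyond this bound the natural-number subtraction of \<open>m\<close> is not
      truncated.\<close>
    using eventually_ge_at_top[of "m + 1"]
  proof eventually_elim
    case (elim t)
    have eq: "t + Suc k + c - m = Suc (t + k + c - m)" using elim by simp
    let ?A = "real t + (real k + 1 + real c - real m)" and ?B = "real ((t + k + c - m) choose k)"
    have "?A = real (Suc (t + k + c - m))"
      using elim by (simp add: of_nat_diff)
    then have step: "?A * ?B = real (Suc (t + k + c - m) choose Suc k) * real (Suc k)"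
      by (metis Suc_times_binomial_eq of_nat_mult)
    have "?A / real t * (?B / real t ^ k) / real (Suc k) = (?A * ?B) / real (Suc k) / real t ^ Suc k"
      by (simp add: mult_ac)
    then show ?case unfolding eq step by (simp del: binomial_Suc_Suc)
  qed
  ultimately show ?case by (simp add: tendsto_cong mult.commute)
qed

text \<open>All binomials are compared with the one at \<open>t + d + 1\<close>, so that the shift of
  \<open>t\<close> by one in the step from block \<open>p - 1\<close> to block \<open>0\<close> is covered by \<open>m \<ge> 0\<close>.\<close>

lemma binomial_difference_asymptotic:
  "(\<lambda>t. (real ((t + Suc k + 1 - m) choose Suc k) - real ((t + Suc k + 1) choose Suc k)) / real t ^ k)
     \<longlonglongrightarrow> - real m / fact k"
proof (induction m)
  case 0
  show ?case by simp
next
  case (Suc m)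
  \<comment> \<open>By Pascal's rule, raising \<open>m\<close> by one subtracts a single binomial of
    lower degree \<open>k\<close>, whose share of the limit is \<open>1 / fact k\<close>.\<close>
  have "(\<lambda>t. (real ((t + Suc k + 1 - m) choose Suc k) - real ((t + Suc k + 1) choose Suc k)) / real t ^ k
          - real ((t + k + 1 - m) choose k) / real t ^ k)
      \<longlonglongrightarrow> - real m / fact k - 1 / fact k"
    by (intro tendsto_intros Suc binomial_shift_asymptotic)
  moreover have "\<forall>\<^sub>F t in sequentially.
      (real ((t + Suc k + 1 - m) choose Suc k) - real ((t + Suc k + 1) choose Suc k)) / real t ^ k
          - real ((t + k + 1 - m) choose k) / real t ^ k
      = (real ((t + Suc k + 1 - Suc m) choose Suc k) - real ((t + Suc k + 1) choose Suc k)) / real t ^ k"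
    using eventually_ge_at_top[of m]
  proof eventually_elim
    case (elim t)
    have eq: "t + Suc k + 1 - m = Suc (t + k + 1 - m)" "t + Suc k + 1 - Suc m = t + k + 1 - m"
      using elim by auto
    show ?case unfolding eq by (simp add: diff_divide_distrib add_divide_distrib)
  qed
  moreover have "- real m / fact k - 1 / fact k = - real (Suc m) / (fact k :: real)"
    by (simp add: diff_divide_distrib)
  ultimately show ?case by (simp only: tendsto_cong)
qed

section \<open>Volumes and first-level gaps as linear functionals\<close>

text \<open>For \<open>r < p\<close> this is \<open>fact d\<close> times the coefficient of
  \<open>t ^ d\<close> in the polynomial giving \<open>L\<close> on residue class
  \<open>r\<close>.\<close>

definition block_volume :: "nat \<Rightarrow> nat \<Rightarrow> (nat \<Rightarrow> 'n::finite) \<Rightarrow> nat \<Rightarrow> real ^ 'n \<Rightarrow> real" where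
  "block_volume d p \<iota> r h = (\<Sum>j\<le>d. block_coord p \<iota> h r j)"

text \<open>Puts the inequalities into one cyclic family indexed by \<open>r < p\<close>: the second
  branch is the step from block \<open>p - 1\<close> to block 0 of the next period.\<close>

definition first_level_gap :: "nat \<Rightarrow> nat \<Rightarrow> (nat \<Rightarrow> 'n::finite) \<Rightarrow> nat \<Rightarrow> real ^ 'n \<Rightarrow> real" where
  "first_level_gap d p \<iota> r h =
     (if r + 1 < p
      then (\<Sum>j\<le>d. real j * block_coord p \<iota> h r j) - (\<Sum>j\<le>d. real j * block_coord p \<iota> h (r + 1) j)
      else (\<Sum>j\<le>d. real (j + 1) * block_coord p \<iota> h (p - 1) j) - (\<Sum>j\<le>d. real j * block_coord p \<iota> h 0 j))"

lemma linear_block_volume: "linear (block_volume d p \<iota> r)"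
  by (rule linearI) (simp_all add: block_volume_def block_coord_def sum.distrib sum_distrib_left)

lemma linear_first_level_gap: "linear (first_level_gap d p \<iota> r)"
  by (rule linearI)
    (simp_all add: first_level_gap_def block_coord_def sum.distrib sum_distrib_left algebra_simps)

lemma volume_equalities_iff:
  "volume_equalities d p \<iota> h
     \<longleftrightarrow> (\<forall>r\<in>{r. r + 1 < p}. block_volume d p \<iota> (r + 1) h - block_volume d p \<iota> r h = 0)"
  by (simp add: volume_equalities_def block_volume_def)

lemma volume_equalities_block_volume:
  assumes "volume_equalities d p \<iota> h" "r < p"
  shows "block_volume d p \<iota> r h = block_volume d p \<iota> 0 h"
  using assms(2) by (induction r) (use assms(1) in \<open>auto simp: volume_equalities_iff\<close>)

lemma first_level_inequalities_iff:
  assumes "p \<ge> 1"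
  shows "first_level_inequalities d p \<iota> h \<longleftrightarrow> (\<forall>r<p. first_level_gap d p \<iota> r h \<ge> 0)"
proof
  assume "first_level_inequalities d p \<iota> h"
  then show "\<forall>r<p. first_level_gap d p \<iota> r h \<ge> 0"
    by (auto simp: first_level_inequalities_def first_level_gap_def)
next
  assume gap: "\<forall>r<p. first_level_gap d p \<iota> r h \<ge> 0"
  from assms obtain q where "p = Suc q" by (cases p) auto
  with gap have "\<forall>r<q. first_level_gap d p \<iota> r h \<ge> 0" "first_level_gap d p \<iota> q h \<ge> 0"
    by auto
  with \<open>p = Suc q\<close> show "first_level_inequalities d p \<iota> h"
    by (simp add: first_level_inequalities_def first_level_gap_def)
qed

section \<open>Growth of \<open>L\<close> along residue classes\<close>

text \<open>The shift \<open>c\<close> lets values from the next period be measured on the same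
  scale \<open>t ^ d\<close>, as the step back to block 0 requires.\<close>

lemma L_leading_asymptotic:
  assumes "p \<ge> 1" "r < p"
  shows "(\<lambda>t. L d p \<iota> h ((t + c) * p + r) / real t ^ d) \<longlonglongrightarrow> block_volume d p \<iota> r h / fact d"
proof -
  have "(\<lambda>t. \<Sum>j\<le>d. block_coord p \<iota> h r j * (real ((t + d + c - j) choose d) / real t ^ d))
      \<longlonglongrightarrow> (\<Sum>j\<le>d. block_coord p \<iota> h r j * (1 / fact d))"
    by (intro tendsto_intros binomial_shift_asymptotic)
  also have "(\<lambda>t. \<Sum>j\<le>d. block_coord p \<iota> h r j * (real ((t + d + c - j) choose d) / real t ^ d))
      = (\<lambda>t. L d p \<iota> h ((t + c) * p + r) / real t ^ d)"
    unfolding L_block[OF assms] by (simp add: sum_divide_distrib add_ac)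
  finally show ?thesis by (simp add: block_volume_def sum_divide_distrib)
qed

text \<open>Subtracting the volume times one reference binomial removes the term of order
  \<open>t ^ d\<close>. The binomial of block entry \<open>j\<close> lies \<open>j + 1 - c\<close>
  places below the reference, and \<open>c \<le> 1\<close> keeps this subtraction exact even at
  \<open>j = 0\<close>.\<close>

lemma L_second_asymptotic:
  assumes p: "p \<ge> 1" "r < p" and d: "d \<ge> 1" and c: "c \<le> 1"
  shows "(\<lambda>t. (L d p \<iota> h ((t + c) * p + r) - block_volume d p \<iota> r h * real ((t + d + 1) choose d))
             / real t ^ (d - 1))
     \<longlonglongrightarrow> - (\<Sum>j\<le>d. real (j + 1 - c) * block_coord p \<iota> h r j) / fact (d - 1)"
proof -
  obtain k where k: "d = Suc k" using d by (cases d) auto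
  have "(\<lambda>t. \<Sum>j\<le>d. block_coord p \<iota> h r j *
        ((real ((t + Suc k + 1 - (j + 1 - c)) choose Suc k) - real ((t + Suc k + 1) choose Suc k)) / real t ^ k))
      \<longlonglongrightarrow> (\<Sum>j\<le>d. block_coord p \<iota> h r j * (- real (j + 1 - c) / fact k))"
    by (intro tendsto_intros binomial_difference_asymptotic)
  also have "(\<Sum>j\<le>d. block_coord p \<iota> h r j * (- real (j + 1 - c) / fact k))
      = - (\<Sum>j\<le>d. real (j + 1 - c) * block_coord p \<iota> h r j) / fact (d - 1)"
    by (simp add: k sum_divide_distrib sum_negf mult.commute del: sum.atMost_Suc)
  also have "(\<lambda>t. \<Sum>j\<le>d. block_coord p \<iota> h r j *
        ((real ((t + Suc k + 1 - (j + 1 - c)) choose Suc k) - real ((t + Suc k + 1) choose Suc k)) / real t ^ k))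
      = (\<lambda>t. (L d p \<iota> h ((t + c) * p + r) - block_volume d p \<iota> r h * real ((t + d + 1) choose d))
             / real t ^ (d - 1))"
  proof
    fix t
    have eq: "t + Suc k + 1 - (j + 1 - c) = t + c + d - j" for j
      using c k by auto
    show "(\<Sum>j\<le>d. block_coord p \<iota> h r j *
        ((real ((t + Suc k + 1 - (j + 1 - c)) choose Suc k) - real ((t + Suc k + 1) choose Suc k)) / real t ^ k))
      = (L d p \<iota> h ((t + c) * p + r) - block_volume d p \<iota> r h * real ((t + d + 1) choose d))
             / real t ^ (d - 1)"
      unfolding eq L_block[OF p] block_volume_def
      by (simp only: k diff_Suc_1 sum_divide_distrib sum_distrib_right right_diff_distrib
          diff_divide_distrib sum_subtractf times_divide_eq_right)
  qed
  finally show ?thesis .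
qed

text \<open>With equal volumes the reference terms of two consecutive residue classes cancel, so the
  increment has order at most \<open>t ^ (d - 1)\<close> and only the moments decide its
  limit.\<close>

lemma L_step_asymptotic:
  assumes p: "p \<ge> 1" and r: "r < p" and d: "d \<ge> 1" and vol: "volume_equalities d p \<iota> h"
  shows "(\<lambda>t. (L d p \<iota> h (t * p + r + 1) - L d p \<iota> h (t * p + r)) / real t ^ (d - 1))
     \<longlonglongrightarrow> first_level_gap d p \<iota> r h / fact (d - 1)"
proof -
  let ?V = "block_volume d p \<iota> 0 h"
  have V: "block_volume d p \<iota> s h = ?V" if "s < p" for s
    using volume_equalities_block_volume[OF vol that] .
  have lim0: "(\<lambda>t. (L d p \<iota> h (t * p + s) - ?V * real ((t + d + 1) choose d)) / real t ^ (d - 1))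
     \<longlonglongrightarrow> - (\<Sum>j\<le>d. real (j + 1) * block_coord p \<iota> h s j) / fact (d - 1)" if "s < p" for s
    using L_second_asymptotic[OF p that d, of 0 \<iota> h] V[OF that] by simp
  \<comment> \<open>Passing from weight \<open>j\<close> to \<open>j + 1\<close> adds the common
    volume, which cancels between two blocks of the same period.\<close>
  have sum_Suc: "(\<Sum>j\<le>d. real (j + 1) * block_coord p \<iota> h s j)
      = (\<Sum>j\<le>d. real j * block_coord p \<iota> h s j) + ?V" if "s < p" for s
    unfolding V[OF that, symmetric] by (simp add: block_volume_def algebra_simps sum.distrib)
  show ?thesis
  proof (cases "r + 1 < p")
    case True
    from tendsto_diff[OF lim0[OF True] lim0[OF r]] show ?thesis
      using True sum_Suc[OF True] sum_Suc[OF r]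
      by (simp add: first_level_gap_def diff_divide_distrib[symmetric] add.assoc)
  next
    case False
    then have rp: "r = p - 1" using r by simp
    \<comment> \<open>Here \<open>t * p + r + 1\<close> equals \<open>(t + 1) * p\<close>, so block
      0 enters with \<open>c = 1\<close> and the weights drop from \<open>j + 1\<close> to
      \<open>j\<close>.\<close>
    have lim1: "(\<lambda>t. (L d p \<iota> h (t * p + r + 1) - ?V * real ((t + d + 1) choose d)) / real t ^ (d - 1))
     \<longlonglongrightarrow> - (\<Sum>j\<le>d. real j * block_coord p \<iota> h 0 j) / fact (d - 1)"
      using L_second_asymptotic[of p 0 d 1 \<iota> h] p d rp by (simp add: algebra_simps)
    from tendsto_diff[OF lim1 lim0[OF r]] show ?thesis
      using False rp by (simp add: first_level_gap_def diff_divide_distrib[symmetric])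
  qed
qed

section \<open>Eventual monotonicity and the linear conditions\<close>

text \<open>There are finitely many residue classes, so their thresholds in \<open>t\<close> have a
  common bound \<open>T\<close>, and \<open>T * p\<close> serves for \<open>n\<close>.\<close>

lemma eventually_sequentially_block:
  assumes p: "p \<ge> (1::nat)"
  shows "(\<forall>\<^sub>F n in sequentially. P n) \<longleftrightarrow> (\<forall>r<p. \<forall>\<^sub>F t in sequentially. P (t * p + r))"
proof
  assume "\<forall>\<^sub>F n in sequentially. P n"
  then obtain N where N: "\<And>n. n \<ge> N \<Longrightarrow> P n" by (auto simp: eventually_sequentially)
  have "P (t * p + r)" if "t \<ge> N" for t r
    using N[of "t * p + r"] that p by (metis le_add1 le_trans mult.right_neutral mult_le_mono)
  then show "\<forall>r<p. \<forall>\<^sub>F t in sequentially. P (t * p + r)"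
    by (auto simp: eventually_sequentially)
next
  assume "\<forall>r<p. \<forall>\<^sub>F t in sequentially. P (t * p + r)"
  then have "\<forall>\<^sub>F t in sequentially. \<forall>r\<in>{..<p}. P (t * p + r)"
    by (intro eventually_ball_finite) auto
  then obtain T where T: "\<And>t r. t \<ge> T \<Longrightarrow> r < p \<Longrightarrow> P (t * p + r)"
    by (auto simp: eventually_sequentially)
  have "P n" if "n \<ge> T * p" for n
  proof -
    have "n div p \<ge> T" using that p by (metis div_le_mono nonzero_mult_div_cancel_right not_one_le_zero)
    then show ?thesis using T[of "n div p" "n mod p"] p by simp
  qed
  then show "\<forall>\<^sub>F n in sequentially. P n" by (auto simp: eventually_sequentially)
qed

lemma eventually_nondecreasing_cone_iff:
  assumes "p \<ge> 1"
  shows "h \<in> eventually_nondecreasing_cone d p \<iota> \<longleftrightarrow>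
    (\<forall>r<p. \<forall>\<^sub>F t in sequentially. L d p \<iota> h (t * p + r + 1) \<ge> L d p \<iota> h (t * p + r))"
proof -
  have "h \<in> eventually_nondecreasing_cone d p \<iota>
      \<longleftrightarrow> (\<forall>\<^sub>F n in sequentially. L d p \<iota> h (n + 1) \<ge> L d p \<iota> h n)"
    by (auto simp: eventually_nondecreasing_cone_def nondecreasing_from_def eventually_sequentially)
  then show ?thesis
    by (subst (asm) eventually_sequentially_block[OF assms]) simp
qed

text \<open>The block volumes increase along \<open>0, \<dots>, p - 1\<close> and the step from block \<open>p - 1\<close>
  back to block \<open>0\<close> closes the cycle.\<close>

lemma nondecreasing_imp_volume_equalities:
  assumes p: "p \<ge> 1" and h: "h \<in> eventually_nondecreasing_cone d p \<iota>"
  shows "volume_equalities d p \<iota> h"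
proof -
  let ?V = "\<lambda>r. block_volume d p \<iota> r h"
  \<comment> \<open>\<open>c\<close> is the carry of the quotient by \<open>p\<close>: 0 for a step
    within a period, 1 for the step from block \<open>p - 1\<close> to block 0.\<close>
  have compare: "?V r \<le> ?V s" if "r < p" "s < p" "\<And>t. t * p + r + 1 = (t + c) * p + s" for r s c
  proof -
    have "\<forall>\<^sub>F t in sequentially. L d p \<iota> h ((t + 0) * p + r) / real t ^ d
        \<le> L d p \<iota> h ((t + c) * p + s) / real t ^ d"
      using h[unfolded eventually_nondecreasing_cone_iff[OF p], rule_format, OF that(1)]
      by eventually_elim (simp add: divide_right_mono that(3)[symmetric])
    then have "?V r / fact d \<le> ?V s / fact d"
      using tendsto_le[OF sequentially_bot L_leading_asymptotic[OF p that(2)] L_leading_asymptotic[OF p that(1)]]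
      by blast
    then show ?thesis by (simp add: divide_le_cancel)
  qed
  have step: "?V r \<le> ?V (Suc r)" if "Suc r < p" for r
    using compare[of r "Suc r" 0] that by simp
  have mono: "?V r \<le> ?V s" if "r \<le> s" "s < p" for r s
    using that by (induction rule: dec_induct) (auto intro: order_trans step)
  have wrap: "?V (p - 1) \<le> ?V 0"
    using compare[of "p - 1" 0 1] p by (simp add: algebra_simps)
  have "?V (r + 1) = ?V r" if "r + 1 < p" for r
  proof (rule antisym)
    have "?V (r + 1) \<le> ?V (p - 1)" using that by (intro mono) auto
    also have "\<dots> \<le> ?V 0" by (fact wrap)
    also have "\<dots> \<le> ?V r" using that by (intro mono) auto
    finally show "?V (r + 1) \<le> ?V r" .
  qed (use step that in simp)
  then show ?thesis by (simp add: volume_equalities_iff)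
qed

text \<open>The volume equalities are already forced, so each gap is, up to a positive factor, a
  limit of eventually nonnegative scaled increments.\<close>

lemma nondecreasing_imp_first_level_inequalities:
  assumes p: "p \<ge> 1" and d: "d \<ge> 1" and h: "h \<in> eventually_nondecreasing_cone d p \<iota>"
  shows "first_level_inequalities d p \<iota> h"
  unfolding first_level_inequalities_iff[OF p]
proof (intro allI impI)
  fix r assume r: "r < p"
  have "\<forall>\<^sub>F t in sequentially. 0 \<le> (L d p \<iota> h (t * p + r + 1) - L d p \<iota> h (t * p + r)) / real t ^ (d - 1)"
    using h[unfolded eventually_nondecreasing_cone_iff[OF p], rule_format, OF r]
    by eventually_elim simp
  then have "0 \<le> first_level_gap d p \<iota> r h / fact (d - 1)"
    using tendsto_lowerbound[OF L_step_asymptotic[OF p r d nondecreasing_imp_volume_equalities[OF p h]]]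
    by simp
  then have "0 * fact (d - 1) \<le> first_level_gap d p \<iota> r h"
    by (simp only: pos_le_divide_eq fact_gt_zero)
  then show "0 \<le> first_level_gap d p \<iota> r h" by simp
qed

text \<open>A positive limit fixes the sign of the increments for large \<open>t\<close>. Strictness
  matters: at a zero gap the terms of lower order decide.\<close>

lemma strict_gaps_imp_nondecreasing:
  assumes p: "p \<ge> 1" and d: "d \<ge> 1" and vol: "volume_equalities d p \<iota> h"
    and gap: "\<And>r. r < p \<Longrightarrow> first_level_gap d p \<iota> r h > 0"
  shows "h \<in> eventually_nondecreasing_cone d p \<iota>"
  unfolding eventually_nondecreasing_cone_iff[OF p]
proof (intro allI impI)
  fix r assume r: "r < p"
  have "\<forall>\<^sub>F t in sequentially. 0 < (L d p \<iota> h (t * p + r + 1) - L d p \<iota> h (t * p + r)) / real t ^ (d - 1)"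
    by (rule order_tendstoD(1)[OF L_step_asymptotic[OF p r d vol]]) (simp add: gap r)
  then show "\<forall>\<^sub>F t in sequentially. L d p \<iota> h (t * p + r) \<le> L d p \<iota> h (t * p + r + 1)"
    using eventually_gt_at_top[of 0]
    by eventually_elim (simp add: zero_less_divide_iff zero_less_power)
qed

text \<open>Each block has a single entry and \<open>L\<close> is constant on each residue class, so
  equal volumes make \<open>L\<close> constant.\<close>

lemma nondecreasing_cone_dim_zero:
  assumes p: "p \<ge> 1"
  shows "eventually_nondecreasing_cone 0 p \<iota> = {h. volume_equalities 0 p \<iota> h}"
proof (intro equalityI subsetI CollectI)
  fix h assume "h \<in> {h. volume_equalities 0 p \<iota> h}"
  then have vol: "volume_equalities 0 p \<iota> h" by simp
  have "L 0 p \<iota> h n = block_volume 0 p \<iota> 0 h" for n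
  proof -
    have "n mod p < p" using p by simp
    from L_block[OF p this, of 0 \<iota> h "n div p"] volume_equalities_block_volume[OF vol this]
    show ?thesis by (simp add: block_volume_def)
  qed
  then show "h \<in> eventually_nondecreasing_cone 0 p \<iota>"
    by (simp add: eventually_nondecreasing_cone_def nondecreasing_from_def)
qed (rule nondecreasing_imp_volume_equalities[OF p])

section \<open>A strictly feasible point and the closure\<close>

lemma exists_strict_gaps:
  fixes \<iota> :: "nat \<Rightarrow> 'n::finite"
  assumes p: "p \<ge> 1" and d: "d \<ge> 1" and bij: "bij_betw \<iota> {..<p * (d + 1)} UNIV"
  obtains h where "volume_equalities d p \<iota> h" "\<forall>r<p. first_level_gap d p \<iota> r h > 0"
proof -
  \<comment> \<open>Only the entries \<open>j = 0\<close> and \<open>j = 1\<close> are used. Every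
    volume is \<open>p\<close> and the moments \<open>p - 1 - r\<close> fall by one per block; the
    last gap is \<open>p - (p - 1)\<close>, so all gaps equal 1.\<close>
  define f :: "nat \<Rightarrow> nat \<Rightarrow> real"
    where "f r j = (if j = 0 then real r + 1 else 0) + (if j = 1 then real p - 1 - real r else 0)" for r j
  define h :: "real ^ 'n"
    where "h = (\<chi> i. let k = inv_into {..<p * (d + 1)} \<iota> i in f (k mod p) (k div p))"
  have coord: "block_coord p \<iota> h r j = f r j" if "r < p" "j \<le> d" for r j
  proof -
    have "j * p + r < j * p + p" using that by simp
    also have "\<dots> \<le> p * (d + 1)"
      using mult_le_mono2[of "j + 1" "d + 1" p] that by (simp add: algebra_simps)
    finally have "inv_into {..<p * (d + 1)} \<iota> (\<iota> (j * p + r)) = j * p + r"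
      using bij by (intro inv_into_f_f) (auto simp: bij_betw_def)
    then show ?thesis using that by (simp add: block_coord_def h_def)
  qed
  have vol: "block_volume d p \<iota> r h = real p" if "r < p" for r
    using that d by (simp add: block_volume_def coord f_def sum.distrib)
  have moment: "(\<Sum>j\<le>d. real j * block_coord p \<iota> h r j) = real p - 1 - real r" if "r < p" for r
  proof -
    have "(\<Sum>j\<le>d. real j * block_coord p \<iota> h r j)
        = (\<Sum>j\<le>d. if j = 1 then real p - 1 - real r else 0)"
      using that by (intro sum.cong) (auto simp: coord f_def)
    then show ?thesis using d by simp
  qed
  have moment': "(\<Sum>j\<le>d. real (j + 1) * block_coord p \<iota> h r j) = 2 * real p - 1 - real r" if "r < p" for r
    using moment[OF that] vol[OF that] by (simp add: block_volume_def algebra_simps sum.distrib)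
  show ?thesis
  proof
    show "volume_equalities d p \<iota> h" by (simp add: volume_equalities_iff vol)
    show "\<forall>r<p. first_level_gap d p \<iota> r h > 0"
      using p moment'[of "p - 1"]
      by (auto simp: first_level_gap_def moment of_nat_diff)
  qed
qed

lemma closure_nondecreasing_cone:
  fixes \<iota> :: "nat \<Rightarrow> 'n::finite"
  assumes p: "p \<ge> 1" and d: "d \<ge> 1" and bij: "bij_betw \<iota> {..<p * (d + 1)} UNIV"
  shows "closure (eventually_nondecreasing_cone d p \<iota>)
           = {h. volume_equalities d p \<iota> h \<and> first_level_inequalities d p \<iota> h}" (is "_ = ?S")
proof
  have "closed ?S"
    unfolding volume_equalities_def first_level_inequalities_def block_coord_def
    by (intro closed_Collect_conj closed_Collect_all closed_Collect_imp closed_Collect_eq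
        closed_Collect_le continuous_intros open_Collect_const)
  then show "closure (eventually_nondecreasing_cone d p \<iota>) \<subseteq> ?S"
    using nondecreasing_imp_volume_equalities[OF p] nondecreasing_imp_first_level_inequalities[OF p d]
    by (intro closure_minimal) auto
  obtain g where g: "volume_equalities d p \<iota> g" "\<forall>r<p. first_level_gap d p \<iota> r g > 0"
    using exists_strict_gaps[OF p d bij] .
  show "?S \<subseteq> closure (eventually_nondecreasing_cone d p \<iota>)"
  proof
    fix h assume h: "h \<in> ?S"
    \<comment> \<open>Linearity keeps the volume equalities, while the positive gaps of
      \<open>g\<close> make every gap of the perturbed point strict.\<close>
    let ?x = "\<lambda>n. h + (1 / real (Suc n)) *\<^sub>R g"
    have "?x n \<in> eventually_nondecreasing_cone d p \<iota>" for n
    proof (rule strict_gaps_imp_nondecreasing[OF p d])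
      show "volume_equalities d p \<iota> (?x n)"
        using h g(1)
        by (simp add: volume_equalities_iff linear_add[OF linear_block_volume]
            linear_scale[OF linear_block_volume])
      fix r assume "r < p"
      then show "first_level_gap d p \<iota> r (?x n) > 0"
        using h g(2)
        by (simp add: first_level_inequalities_iff[OF p] linear_add[OF linear_first_level_gap]
            linear_scale[OF linear_first_level_gap] add_nonneg_pos)
    qed
    moreover have "?x \<longlonglongrightarrow> h + 0 *\<^sub>R g"
      by (intro tendsto_intros LIMSEQ_Suc[OF lim_1_over_n])
    ultimately show "h \<in> closure (eventually_nondecreasing_cone d p \<iota>)"
      unfolding closure_sequential by (intro exI[of _ ?x]) simp
  qed
qed

section \<open>Polyhedrality of linear systems\<close>

lemma polyhedron_linear_le:
  fixes f :: "'a::euclidean_space \<Rightarrow> real"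
  assumes "linear f"
  shows "polyhedron {x. f x \<le> 0}"
proof -
  \<comment> \<open>The adjoint of the functional, evaluated at 1, is the normal vector of the
    halfspace.\<close>
  have "f x = adjoint f 1 \<bullet> x" for x
    using adjoint_works[OF assms, of x 1] by (simp add: inner_commute)
  then show ?thesis by (simp add: polyhedron_halfspace_le)
qed

lemma polyhedron_linear_system:
  fixes f :: "'i \<Rightarrow> 'a::euclidean_space \<Rightarrow> real"
  assumes "finite I" "\<And>i. i \<in> I \<Longrightarrow> linear (f i)"
  shows "polyhedron {x. \<forall>i\<in>I. f i x \<le> 0}"
proof -
  have "{x. \<forall>i\<in>I. f i x \<le> 0} = (\<Inter>i\<in>I. {x. f i x \<le> 0})" by auto
  then show ?thesis using assms by (auto intro!: polyhedron_Inter polyhedron_linear_le)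
qed

text \<open>Each equality is split into two opposite inequalities.\<close>

lemma polyhedron_volume_equalities: "polyhedron {h. volume_equalities d p \<iota> h}"
proof -
  let ?f = "\<lambda>r h. block_volume d p \<iota> (r + 1) h - block_volume d p \<iota> r h"
  have eq: "{h. volume_equalities d p \<iota> h}
      = {h. \<forall>r\<in>{r. r + 1 < p}. ?f r h \<le> 0} \<inter> {h. \<forall>r\<in>{r. r + 1 < p}. - ?f r h \<le> 0}"
    by (force simp: volume_equalities_iff)
  have "finite {r. r + 1 < p}" by (rule finite_subset[of _ "{..<p}"]) auto
  then show ?thesis
    unfolding eq
    by (intro polyhedron_Int polyhedron_linear_system linear_compose_sub linear_compose_neg
        linear_block_volume)
qed

lemma polyhedron_first_level_inequalities:
  assumes "p \<ge> 1"
  shows "polyhedron {h. first_level_inequalities d p \<iota> h}"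
proof -
  have "polyhedron {h. \<forall>r\<in>{..<p}. - first_level_gap d p \<iota> r h \<le> 0}"
    by (intro polyhedron_linear_system linear_compose_neg linear_first_level_gap) simp
  then show ?thesis by (simp add: first_level_inequalities_iff[OF assms] Ball_def)
qed

section \<open>Dimension of the solution space of the volume equalities\<close>

lemma subspace_volume_equalities: "subspace {h. volume_equalities d p \<iota> h}"
  by (rule subspaceI)
    (simp_all add: volume_equalities_iff linear_0[OF linear_block_volume]
      linear_add[OF linear_block_volume] linear_scale[OF linear_block_volume])

text \<open>The map \<open>T\<close> replaces the coordinates \<open>h\<^bsub>r,0\<^esub>\<close> with \<open>1 \<le> r < p\<close> by the
  differences of consecutive block volumes and keeps all others, so that it carries the solution
  space of the volume equalities to a coordinate subspace.\<close>

lemma dim_volume_equalities: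
  fixes \<iota> :: "nat \<Rightarrow> 'n::finite"
  assumes p: "p \<ge> 1" and bij: "bij_betw \<iota> {..<p * (d + 1)} UNIV"
  shows "dim {h. volume_equalities d p \<iota> h} = p * d + 1"
proof -
  define I where "I = \<iota> ` {1..<p}"
  define T :: "real ^ 'n \<Rightarrow> real ^ 'n" where
    "T h = (\<chi> i. let k = inv_into {..<p * (d + 1)} \<iota> i in
       if k \<in> {1..<p} then block_volume d p \<iota> k h - block_volume d p \<iota> (k - 1) h else h $ i)" for h
  have inj: "inj_on \<iota> {..<p * (d + 1)}" and surj: "\<iota> ` {..<p * (d + 1)} = UNIV"
    using bij by (auto simp: bij_betw_def)
  have inv: "inv_into {..<p * (d + 1)} \<iota> (\<iota> k) = k" if "k < p * (d + 1)" for k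
    using inj that by (intro inv_into_f_f) auto
  have sub: "{1..<p} \<subseteq> {..<p * (d + 1)}" by auto
  have T: "T h $ \<iota> k = (if k \<in> {1..<p} then block_volume d p \<iota> k h - block_volume d p \<iota> (k - 1) h
      else h $ \<iota> k)" if "k < p * (d + 1)" for h k
    using inv[OF that] by (simp add: T_def)
  have lin: "linear T"
    by (rule linearI) (simp_all add: T_def vec_eq_iff Let_def linear_add[OF linear_block_volume]
      linear_scale[OF linear_block_volume] algebra_simps)
  have vol: "volume_equalities d p \<iota> h \<longleftrightarrow> (\<forall>i\<in>I. T h $ i = 0)" for h
  proof -
    have "(\<forall>i\<in>I. T h $ i = 0)
        \<longleftrightarrow> (\<forall>k\<in>{1..<p}. block_volume d p \<iota> k h - block_volume d p \<iota> (k - 1) h = 0)"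
      using sub by (auto simp: I_def T subset_iff)
    also have "\<dots> \<longleftrightarrow> volume_equalities d p \<iota> h"
    proof
      assume *: "\<forall>k\<in>{1..<p}. block_volume d p \<iota> k h - block_volume d p \<iota> (k - 1) h = 0"
      show "volume_equalities d p \<iota> h"
        unfolding volume_equalities_iff using *[rule_format, of "_ + 1"] by simp
    next
      assume veq: "volume_equalities d p \<iota> h"
      show "\<forall>k\<in>{1..<p}. block_volume d p \<iota> k h - block_volume d p \<iota> (k - 1) h = 0"
      proof
        fix k assume "k \<in> {1..<p}"
        then have "k < p" "k - 1 < p" by auto
        from this[THEN volume_equalities_block_volume[OF veq]]
        show "block_volume d p \<iota> k h - block_volume d p \<iota> (k - 1) h = 0" by simp
      qed
    qed
    finally show ?thesis by simp
  qed
  have "inj T"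
    unfolding linear_injective_0[OF lin]
  proof (intro allI impI)
    fix h assume Th: "T h = 0"
    then have veq: "volume_equalities d p \<iota> h" by (simp add: vol)
    have zero: "h $ \<iota> k = 0" if "k < p * (d + 1)" "k \<notin> {1..<p}" for k
      using T[OF that(1), of h, unfolded if_not_P[OF that(2)]] Th by simp
    \<comment> \<open>All coordinates with index at least \<open>p\<close> are kept by
      \<open>T\<close> and hence vanish, so each volume reduces to its entry at
      \<open>j = 0\<close>.\<close>
    have head: "block_volume d p \<iota> r h = h $ \<iota> r" if "r < p" for r
    proof -
      have "block_coord p \<iota> h r j = (if j = 0 then h $ \<iota> r else 0)" if "j \<le> d" for j
      proof (cases "j = 0")
        case False
        have "j * p + r < j * p + p" using \<open>r < p\<close> by simp
        also have "\<dots> \<le> p * (d + 1)"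
          using mult_le_mono2[of "j + 1" "d + 1" p] that by (simp add: algebra_simps)
        finally have "j * p + r < p * (d + 1)" .
        moreover have "p \<le> j * p + r" using mult_le_mono1[of 1 j p] False by linarith
        then have "j * p + r \<notin> {1..<p}" by (metis atLeastLessThan_iff not_less)
        ultimately have "h $ \<iota> (j * p + r) = 0" by (rule zero)
        then show ?thesis using False by (simp add: block_coord_def)
      qed (simp add: block_coord_def)
      then show ?thesis by (simp add: block_volume_def)
    qed
    \<comment> \<open>Index 0 is also kept by \<open>T\<close>, so the volume of block 0 vanishes,
      and equality of volumes spreads this to the remaining heads.\<close>
    have "h $ \<iota> 0 = 0" using zero[of 0] p by simp
    then have "h $ \<iota> k = 0" if "k < p * (d + 1)" for k
      using zero[OF that] head[of k] head[of 0] volume_equalities_block_volume[OF veq, of k] p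
      by (cases "k < p") auto
    then show "h = 0"
      using surj by (metis (no_types, lifting) UNIV_I image_iff lessThan_iff vec_eq_iff zero_index)
  qed
  then have "surj T" using linear_injective_imp_surjective[OF lin] by simp
  \<comment> \<open>The solution space is the full preimage of a coordinate subspace, so
    surjectivity of \<open>T\<close> makes its image that whole subspace.\<close>
  then have image: "T ` {h. volume_equalities d p \<iota> h} = {x. \<forall>i. i \<notin> - I \<longrightarrow> x $ i = 0}"
    using surj_image_vimage_eq[OF \<open>surj T\<close>, of "{x. \<forall>i\<in>I. x $ i = 0}"]
    by (simp add: vol Ball_def vimage_def)
  have "card I = p - 1"
    unfolding I_def using inj sub by (simp add: card_image inj_on_subset)
  moreover have "CARD('n) = p * (d + 1)"
    using bij_betw_same_card[OF bij] by simp
  ultimately have card: "card (- I) = p * d + 1"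
    using p by (simp add: Compl_eq_Diff_UNIV card_Diff_subset)
  have "dim {h. volume_equalities d p \<iota> h} = dim (T ` {h. volume_equalities d p \<iota> h})"
    using dim_image_eq[OF lin inj_on_subset[OF \<open>inj T\<close> subset_UNIV]] by simp
  also have "\<dots> = card (- I)"
    unfolding image using dim_substandard_cart[of "- I", where 'a = real] by (simp add: dim_vec_eq)
  finally show ?thesis using card by simp
qed

section \<open>Polyhedrality and dimension of the closed cone\<close>

theorem corollary3p5:
  fixes d p :: nat and \<iota> :: "nat \<Rightarrow> 'n::finite"
  assumes "p \<ge> 1"
    and "bij_betw \<iota> {..<p * (d + 1)} UNIV"
  shows "polyhedron (closure (eventually_nondecreasing_cone d p \<iota>))
    \<and> cone (closure (eventually_nondecreasing_cone d p \<iota>))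
    \<and> aff_dim (closure (eventually_nondecreasing_cone d p \<iota>)) = int (p * d + 1)
    \<and> (d \<ge> 1 \<longrightarrow>
         closure (eventually_nondecreasing_cone d p \<iota>)
           = {h. volume_equalities d p \<iota> h \<and> first_level_inequalities d p \<iota> h})"
proof -
  let ?E = "{h. volume_equalities d p \<iota> h}"
  have dimE: "aff_dim ?E = int (p * d + 1)"
    using aff_dim_subspace[OF subspace_volume_equalities] dim_volume_equalities[OF assms] by metis
  show ?thesis
  proof (cases "d = 0")
    case True
    \<comment> \<open>For \<open>d = 0\<close> the cone is already a linear subspace, hence
      closed.\<close>
    have eq: "closure (eventually_nondecreasing_cone d p \<iota>) = ?E"
      using nondecreasing_cone_dim_zero[OF assms(1)] True
        closure_closed[OF closed_subspace[OF subspace_volume_equalities]] by metis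
    have "cone ?E"
      unfolding cone_def using subspace_scale[OF subspace_volume_equalities] by blast
    then show ?thesis
      unfolding eq using True dimE by (simp add: polyhedron_volume_equalities)
  next
    case False
    then have d: "d \<ge> 1" by simp
    let ?S = "{h. volume_equalities d p \<iota> h \<and> first_level_inequalities d p \<iota> h}"
    let ?U = "{h. \<forall>r\<in>{..<p}. first_level_gap d p \<iota> r h > 0}"
    have "polyhedron ?S"
      using polyhedron_Int[OF polyhedron_volume_equalities polyhedron_first_level_inequalities[OF assms(1)]]
      by (simp add: Collect_conj_eq)
    moreover have "cone ?S"
      by (auto simp: cone_def first_level_inequalities_iff[OF assms(1)] volume_equalities_iff
          linear_scale[OF linear_block_volume] linear_scale[OF linear_first_level_gap])
    moreover have "aff_dim ?S = int (p * d + 1)"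
    proof -
      have "open {h. first_level_gap d p \<iota> r h > 0}" for r
        using linear_first_level_gap[of d p \<iota> r]
        by (intro open_Collect_less continuous_intros linear_continuous_on)
          (simp_all add: linear_conv_bounded_linear)
      then have "open (\<Inter>r\<in>{..<p}. {h. first_level_gap d p \<iota> r h > 0})"
        by (intro open_INT) simp_all
      moreover have "(\<Inter>r\<in>{..<p}. {h. first_level_gap d p \<iota> r h > 0}) = ?U" by auto
      ultimately have "open ?U" by (simp only:)
      moreover obtain g where "volume_equalities d p \<iota> g" "\<forall>r<p. first_level_gap d p \<iota> r g > 0"
        using exists_strict_gaps[OF assms(1) d assms(2)] .
      then have "g \<in> ?E \<inter> ?U" by simp
      then have "?E \<inter> ?U \<noteq> {}" by (metis empty_iff)
      \<comment> \<open>A nonempty relatively open part of a subspace spans it affinely. As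
        \<open>?S\<close> lies between \<open>?E \<inter> ?U\<close> and \<open>?E\<close>, its
        dimension is that of \<open>?E\<close>.\<close>
      ultimately have hull: "affine hull (?E \<inter> ?U) = affine hull ?E"
        by (rule affine_hull_affine_Int_open[OF subspace_imp_affine, OF subspace_volume_equalities])
      have "aff_dim (?E \<inter> ?U) = int (p * d + 1)"
        using aff_dim_affine_hull[of "?E \<inter> ?U"] unfolding hull aff_dim_affine_hull dimE by (rule sym)
      moreover have "aff_dim (?E \<inter> ?U) \<le> aff_dim ?S"
        by (intro aff_dim_subset) (auto simp: first_level_inequalities_iff[OF assms(1)] less_imp_le)
      moreover have "aff_dim ?S \<le> aff_dim ?E"
        by (intro aff_dim_subset) auto
      ultimately show ?thesis using dimE by linarith
    qed
    ultimately show ?thesis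
      unfolding closure_nondecreasing_cone[OF assms(1) d assms(2)] by simp
  qed
qed

end
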